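(* Let $G=(V,E,w)$ be a graph on $n$ vertices with nonnegative weights $w_{ij}$. The algorithm \texttt{Recursive-Random-Cutting} outputs a hierarchical clustering $T$ whose expected objective $\mathbb{E}\big[\sum_{(i,j)\in E}w_{ij}|T_{ij}|\big]$ is at least $\frac23\max_{T'}\sum_{(i,j)\in E}w_{ij}|T'_{ij}|$, the maximum over all hierarchical clusterings $T'$ on $V$.
   Context: A hierarchical clustering on $V$ is a rooted binary tree with leaf set $V$; $T_{ij}$ is the subtree rooted at the lowest common ancestor of $i,j$, and $|T_{ij}|$ its number of leaves (the dissimilarity-HC objective is to maximize $\sum w_{ij}|T_{ij}|$). \texttt{Recursive-Random-Cutting}: a cluster $A$ with $|A|\ge2$ is split by having each point of $A$ independently flip a fair coin and placing it in the left or right part accordingly (if one part is empty, the coin flips are repeated); the algorithm recurses on both parts until all clusters are singletons, and the parts become the children of $A$ in the tree. *)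

theory Defs
  imports "HOL-Probability.Probability"
begin

(* Rooted binary trees with labelled leaves: every inner node has exactly two children.  The
   order of the two children is recorded but affects neither hclustering nor dissim_obj. *)
datatype 'a hctree = HLeaf 'a | HNode "'a hctree" "'a hctree"

fun leaves :: "'a hctree \<Rightarrow> 'a list" where
  "leaves (HLeaf x) = [x]"
| "leaves (HNode l r) = leaves l @ leaves r"

fun hc_subtrees :: "'a hctree \<Rightarrow> 'a hctree set" where
  "hc_subtrees (HLeaf x) = {HLeaf x}"
| "hc_subtrees (HNode l r) = insert (HNode l r) (hc_subtrees l \<union> hc_subtrees r)"

definition hclustering :: "'a set \<Rightarrow> 'a hctree \<Rightarrow> bool" where
  "hclustering V T \<longleftrightarrow> distinct (leaves T) \<and> set (leaves T) = V"

(* The subtree rooted at the lowest common ancestor of the leaves in e; T_ij is the case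
   e = {i, j}.  See lca_subtree_lowest below. *)
fun lca_subtree :: "'a hctree \<Rightarrow> 'a set \<Rightarrow> 'a hctree" where
  "lca_subtree (HLeaf x) e = HLeaf x"
| "lca_subtree (HNode l r) e =
    (if e \<subseteq> set (leaves l) then lca_subtree l e
     else if e \<subseteq> set (leaves r) then lca_subtree r e
     else HNode l r)"

(* Dissimilarity objective; edges are two-element sets e = {i, j}. *)
definition dissim_obj :: "'a set set \<Rightarrow> ('a set \<Rightarrow> real) \<Rightarrow> 'a hctree \<Rightarrow> real" where
  "dissim_obj E w T = (\<Sum>e\<in>E. w e * real (length (leaves (lca_subtree T e))))"

(* The recursive call on the same A repeats the coin flips when one part is empty.  Failure mass
   of the spmf is the probability of non-termination. *)
partial_function (spmf) recursive_random_cutting :: "'a set \<Rightarrow> 'a hctree spmf" where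
  "recursive_random_cutting A =
    (if 2 \<le> card A then
       bind_spmf (spmf_of_pmf (Pi_pmf A False (\<lambda>_. bernoulli_pmf (1/2)))) (\<lambda>f.
         if {x \<in> A. f x} = {} \<or> {x \<in> A. \<not> f x} = {} then recursive_random_cutting A
         else
           bind_spmf (recursive_random_cutting {x \<in> A. f x}) (\<lambda>l.
           bind_spmf (recursive_random_cutting {x \<in> A. \<not> f x}) (\<lambda>r.
             return_spmf (HNode l r))))
     else return_spmf (HLeaf (the_elem A)))"

lemma self_in_hc_subtrees: "T \<in> hc_subtrees T"
  by (cases T) auto

lemma leaves_subtree: "S \<in> hc_subtrees T \<Longrightarrow> set (leaves S) \<subseteq> set (leaves T)"
  by (induction T) auto

lemma lca_subtree_lowest:
  assumes "distinct (leaves T)" "e \<noteq> {}" "e \<subseteq> set (leaves T)"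
  shows "lca_subtree T e \<in> hc_subtrees T" "e \<subseteq> set (leaves (lca_subtree T e))"
    and "\<And>S. S \<in> hc_subtrees T \<Longrightarrow> e \<subseteq> set (leaves S) \<Longrightarrow> lca_subtree T e \<in> hc_subtrees S"
proof -
  have "lca_subtree T e \<in> hc_subtrees T \<and> e \<subseteq> set (leaves (lca_subtree T e)) \<and>
    (\<forall>S\<in>hc_subtrees T. e \<subseteq> set (leaves S) \<longrightarrow> lca_subtree T e \<in> hc_subtrees S)"
    using assms
  proof (induction T)
    case (HLeaf x)
    then show ?case by auto
  next
    case (HNode l r)
    have disj: "set (leaves l) \<inter> set (leaves r) = {}"
      using HNode.prems by auto
    consider (l) "e \<subseteq> set (leaves l)" "\<not> e \<subseteq> set (leaves r)"
      | (r) "e \<subseteq> set (leaves r)" "\<not> e \<subseteq> set (leaves l)"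
      | (n) "\<not> e \<subseteq> set (leaves l)" "\<not> e \<subseteq> set (leaves r)"
      using disj HNode.prems by blast
    then show ?case
    proof cases
      case l
      moreover have "\<not> e \<subseteq> set (leaves S)" if "S \<in> hc_subtrees r" for S
        using that l leaves_subtree[of S r] by blast
      ultimately show ?thesis using HNode by auto
    next
      case r
      moreover have "\<not> e \<subseteq> set (leaves S)" if "S \<in> hc_subtrees l" for S
        using that r leaves_subtree[of S l] by blast
      ultimately show ?thesis using HNode by auto
    next
      case n
      moreover have "\<not> e \<subseteq> set (leaves S)" if "S \<in> hc_subtrees l \<union> hc_subtrees r" for S
        using that n leaves_subtree[of S l] leaves_subtree[of S r] by blast
      ultimately show ?thesis using HNode.prems by (auto simp: self_in_hc_subtrees)
    qed
  qed
  then show "lca_subtree T e \<in> hc_subtrees T" "e \<subseteq> set (leaves (lca_subtree T e))"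
    and "\<And>S. S \<in> hc_subtrees T \<Longrightarrow> e \<subseteq> set (leaves S) \<Longrightarrow> lca_subtree T e \<in> hc_subtrees S"
    by auto
qed

lemma leaves_nonempty: "leaves T \<noteq> []"
  by (induction T) auto

lemma finite_hclusterings:
  assumes "finite V"
  shows "finite {T. hclustering V T}"
  using assms
proof (induction V rule: finite_psubset_induct)
  case (psubset V)
  let ?N = "\<Union>A\<in>{A. A \<subset> V}. {T. hclustering A T}"
  have "{T. hclustering V T} \<subseteq> HLeaf ` V \<union> (\<lambda>(l, r). HNode l r) ` (?N \<times> ?N)"
  proof
    fix T assume "T \<in> {T. hclustering V T}"
    then have T: "hclustering V T" by simp
    show "T \<in> HLeaf ` V \<union> (\<lambda>(l, r). HNode l r) ` (?N \<times> ?N)"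
    proof (cases T)
      case (HLeaf x)
      then show ?thesis using T by (auto simp: hclustering_def)
    next
      case (HNode l r)
      have "A \<subset> V \<and> B \<subset> V" if "A \<noteq> {}" "B \<noteq> {}" "A \<inter> B = {}" "V = A \<union> B" for A B
        using that by auto
      from this[of "set (leaves l)" "set (leaves r)"]
      have "set (leaves l) \<subset> V" and "set (leaves r) \<subset> V"
        using T HNode by (auto simp: hclustering_def leaves_nonempty)
      moreover have "x \<in> ?N" if "set (leaves x) \<subset> V" "distinct (leaves x)" for x
        by (rule UN_I[of "set (leaves x)"]) (use that in \<open>simp_all add: hclustering_def\<close>)
      moreover have "distinct (leaves l)" "distinct (leaves r)"
        using T HNode by (simp_all add: hclustering_def)
      ultimately have "(l, r) \<in> ?N \<times> ?N"
        by (meson SigmaI)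
      then have "(case (l, r) of (l, r) \<Rightarrow> HNode l r) \<in> (\<lambda>(l, r). HNode l r) ` (?N \<times> ?N)"
        by (rule imageI)
      then show ?thesis
        unfolding HNode prod.case by (rule UnI2)
    qed
  qed
  moreover have "finite {A. A \<subset> V}"
    by (rule finite_subset[of _ "Pow V"]) (use psubset.hyps in auto)
  then have "finite ?N"
    by (rule finite_UN_I) (use psubset.IH in simp)
  then have "finite (HLeaf ` V \<union> (\<lambda>(l, r). HNode l r) ` (?N \<times> ?N))"
    using psubset.hyps by simp
  ultimately show ?case
    by (rule finite_subset)
qed

lemma ex_hclustering:
  assumes "finite V" "V \<noteq> {}"
  shows "\<exists>T. hclustering V T"
  using assms
proof (induction V rule: finite_ne_induct)
  case (singleton x)
  have "hclustering {x} (HLeaf x)" by (simp add: hclustering_def)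
  then show ?case by blast
next
  case (insert x F)
  then obtain T where "hclustering F T" by auto
  then have "hclustering (insert x F) (HNode (HLeaf x) T)"
    using insert by (simp add: hclustering_def)
  then show ?case by blast
qed

end

theory Submission
  imports Defs
begin

text \<open>Rejecting the cuts with an empty part makes the first cut of a cluster \<open>A\<close> uniform over
  the nonempty proper subsets of \<open>A\<close>. Induction on \<open>A\<close> then gives, for distinct \<open>i, j \<in> A\<close> and
  \<open>n = |A|\<close>, the exact value \<open>E |T\<^sub>i\<^sub>j| = (2 n + 2) / 3\<close>: for a set \<open>C\<close> avoiding \<open>i\<close> and \<open>j\<close>, the
  four cuts \<open>C\<close>, \<open>C \<union> {i}\<close>, \<open>C \<union> {j}\<close>, \<open>C \<union> {i, j}\<close> contribute a total that does not depend
  on \<open>C\<close>. As \<open>|T'\<^sub>i\<^sub>j| \<le> n\<close> in every tree, the bound follows edge by edge.\<close>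

section \<open>The law of the first cut\<close>

text \<open>At each point the hypothesis is a linear equation for \<open>pmf q y\<close>: the
  retries contribute \<open>card (S \<inter> R) * pmf q y\<close>. Since \<open>S - R\<close> is
  nonempty, it has exactly one solution, so no minimality of the fixed point enters. For an spmf,
  the failure value is one of the points \<open>y\<close>.\<close>

lemma bind_pmf_of_set_retry:
  fixes q :: "'b pmf"
  assumes q: "q = bind_pmf (pmf_of_set S) (\<lambda>x. if x \<in> R then q else g x)"
    and "finite S" and "S - R \<noteq> {}"
  shows "q = bind_pmf (pmf_of_set (S - R)) g"
proof (rule pmf_eqI)
  fix y
  have S: "S \<noteq> {}" using assms(3) by auto
  have "pmf q y = (\<Sum>x\<in>S. pmf (if x \<in> R then q else g x) y) / card S"
    by (subst q) (simp add: pmf_bind integral_pmf_of_set S \<open>finite S\<close>)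
  also have "(\<Sum>x\<in>S. pmf (if x \<in> R then q else g x) y)
      = (\<Sum>x\<in>S - R. pmf (g x) y) + (\<Sum>x\<in>S \<inter> R. pmf q y)"
    using \<open>finite S\<close> by (subst sum.Int_Diff[of _ _ R]) (auto intro!: sum.cong)
  finally have "pmf q y * (real (card S) - card (S \<inter> R)) = (\<Sum>x\<in>S - R. pmf (g x) y)"
    using S \<open>finite S\<close> by (simp add: field_simps)
  moreover have "real (card S) - card (S \<inter> R) = card (S - R)"
    using card_Diff_subset_Int[of S R] \<open>finite S\<close> by (simp add: card_mono of_nat_diff)
  moreover have "card (S - R) \<noteq> 0" using assms(2,3) by simp
  ultimately show "pmf q y = pmf (bind_pmf (pmf_of_set (S - R)) g) y"
    using assms(2,3) by (simp add: pmf_bind integral_pmf_of_set field_simps)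
qed

lemma nontrivial_subsets:
  assumes "2 \<le> card A"
  shows "finite (Pow A - {{}, A})" "Pow A - {{}, A} \<noteq> {}"
proof -
  have A: "finite A" using assms by (intro card_ge_0_finite) simp
  then show "finite (Pow A - {{}, A})" by simp
  have "A \<noteq> {}" using assms by auto
  then obtain x where "x \<in> A" by blast
  moreover have "card {x} \<noteq> card A" using assms by simp
  then have "{x} \<noteq> A" by (rule contrapos_nn) simp
  ultimately have "{x} \<in> Pow A - {{}, A}" by simp
  then show "Pow A - {{}, A} \<noteq> {}" by (metis emptyE)
qed

text \<open>Independent fair coins make the set of heads uniform on \<open>Pow A\<close>; repeating
  the flips on \<open>{}\<close> and \<open>A\<close> then conditions it on the remaining
  subsets.\<close>

lemma recursive_random_cutting_rec:
  assumes "2 \<le> card A"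
  shows "recursive_random_cutting A = bind_pmf (pmf_of_set (Pow A - {{}, A})) (\<lambda>B.
    bind_spmf (recursive_random_cutting B) (\<lambda>l.
    bind_spmf (recursive_random_cutting (A - B)) (\<lambda>r. return_spmf (HNode l r))))"
    (is "?q = bind_pmf _ ?g")
proof (rule bind_pmf_of_set_retry)
  have A: "finite A" using assms by (intro card_ge_0_finite) simp
  have "?q = bind_pmf (Pi_pmf A False (\<lambda>_. bernoulli_pmf (1/2)))
    (\<lambda>f. if {x \<in> A. f x} \<in> {{}, A} then ?q else ?g {x \<in> A. f x})"
  proof -
    have parts: "A - {x \<in> A. f x} = {x \<in> A. \<not> f x}" "{x \<in> A. f x} \<in> {{}, A} \<longleftrightarrow>
        {x \<in> A. f x} = {} \<or> {x \<in> A. \<not> f x} = {}" for f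
      by auto
    show ?thesis
      unfolding parts
      \<comment> \<open>Only the outer call is unfolded; the repeated call has to stay
        \<open>?q\<close>.\<close>
      by (rule trans[OF recursive_random_cutting.simps])
        (simp only: assms if_True bind_spmf_of_pmf)
  qed
  also have "\<dots> = bind_pmf (pmf_of_set (Pow A)) (\<lambda>B. if B \<in> {{}, A} then ?q else ?g B)"
    unfolding pmf_of_set_Pow_conv_bernoulli[OF A, of False, symmetric] bind_map_pmf ..
  finally show "?q = bind_pmf (pmf_of_set (Pow A)) (\<lambda>B. if B \<in> {{}, A} then ?q else ?g B)" .
  show "finite (Pow A)" using A by simp
  show "Pow A - {{}, A} \<noteq> {}" using nontrivial_subsets[OF assms] by simp
qed

lemma recursive_random_cutting_singleton:
  "recursive_random_cutting {x} = return_spmf (HLeaf x)"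
  by (subst recursive_random_cutting.simps) simp

text \<open>This follows the recursion with the retries eliminated: both parts of a nontrivial cut
  are nonempty and strictly smaller than the cluster.\<close>

lemma cluster_induct [consumes 2, case_names singleton cut]:
  assumes "finite A" "A \<noteq> {}"
    and "\<And>x. P {x}"
    and "\<And>A. finite A \<Longrightarrow> 2 \<le> card A \<Longrightarrow>
      (\<And>B. B \<in> Pow A - {{}, A} \<Longrightarrow> P B \<and> P (A - B)) \<Longrightarrow> P A"
  shows "P A"
  using assms(1,2)
proof (induction A rule: finite_psubset_induct)
  case (psubset A)
  show ?case
  proof (cases "2 \<le> card A")
    case True
    show ?thesis
    proof (rule assms(4)[OF psubset.hyps True])
      fix B assume "B \<in> Pow A - {{}, A}"
      then have "B \<subset> A" "B \<noteq> {}" "A - B \<subset> A" "A - B \<noteq> {}" by auto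
      then show "P B \<and> P (A - B)" using psubset.IH by blast
    qed
  next
    case False
    then have "card A = 1" using psubset.hyps psubset.prems card_gt_0_iff[of A] by linarith
    then show ?thesis using assms(3) by (auto simp: card_1_singleton_iff)
  qed
qed

section \<open>Almost sure termination and the law of the output tree\<close>

lemma lossless_recursive_random_cutting:
  assumes "finite A" "A \<noteq> {}"
  shows "lossless_spmf (recursive_random_cutting A)"
  using assms
proof (induction A rule: cluster_induct)
  case (singleton x)
  then show ?case by (simp add: recursive_random_cutting_singleton)
next
  case (cut A)
  then show ?case
    \<comment> \<open>The choice of the cut is itself lossless, and both recursive calls are by
      induction.\<close>
    unfolding recursive_random_cutting_rec[OF cut(2)] bind_spmf_of_pmf[symmetric]
      lossless_bind_spmf
    using nontrivial_subsets[OF cut(2)] by (simp del: bind_spmf_of_pmf spmf_of_pmf_pmf_of_set)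
qed

text \<open>On a finite nonempty cluster \<open>None\<close> has probability 0, so
  \<open>the\<close> loses nothing and expectations can be taken over an ordinary
  \<open>pmf\<close>.\<close>

definition cutting_pmf :: "'a set \<Rightarrow> 'a hctree pmf" where
  "cutting_pmf A = map_pmf the (recursive_random_cutting A)"

lemma map_the_spmf_of_pmf: "map_pmf the (spmf_of_pmf p) = p"
  by (simp add: spmf_of_pmf_def pmf.map_comp o_def)

lemma spmf_of_cutting_pmf:
  assumes "finite A" "A \<noteq> {}"
  shows "recursive_random_cutting A = spmf_of_pmf (cutting_pmf A)"
  using lossless_recursive_random_cutting[OF assms]
  by (auto simp: cutting_pmf_def lossless_spmf_conv_spmf_of_pmf map_the_spmf_of_pmf)

lemma cutting_pmf_singleton: "cutting_pmf {x} = return_pmf (HLeaf x)"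
  by (simp add: cutting_pmf_def recursive_random_cutting_singleton)

lemma cutting_pmf_rec:
  assumes "2 \<le> card A"
  shows "cutting_pmf A = bind_pmf (pmf_of_set (Pow A - {{}, A})) (\<lambda>B.
    map_pmf (\<lambda>(l, r). HNode l r) (pair_pmf (cutting_pmf B) (cutting_pmf (A - B))))"
proof -
  have A: "finite A" using assms by (intro card_ge_0_finite) simp
  have "recursive_random_cutting A = bind_pmf (pmf_of_set (Pow A - {{}, A})) (\<lambda>B. spmf_of_pmf
    (map_pmf (\<lambda>(l, r). HNode l r) (pair_pmf (cutting_pmf B) (cutting_pmf (A - B)))))"
    unfolding recursive_random_cutting_rec[OF assms]
  \<comment> \<open>Restricting to cuts in the support makes both parts finite and nonempty, where
    the two laws are known to agree.\<close>
  proof (rule bind_pmf_cong[OF refl])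
    fix B assume "B \<in> set_pmf (pmf_of_set (Pow A - {{}, A}))"
    then have B: "B \<subseteq> A" "B \<noteq> {}" "A - B \<noteq> {}"
      using nontrivial_subsets[OF assms] by auto
    show "bind_spmf (recursive_random_cutting B) (\<lambda>l.
        bind_spmf (recursive_random_cutting (A - B)) (\<lambda>r. return_spmf (HNode l r)))
      = spmf_of_pmf (map_pmf (\<lambda>(l, r). HNode l r)
          (pair_pmf (cutting_pmf B) (cutting_pmf (A - B))))"
      using B A finite_subset[OF B(1) A]
      by (simp add: spmf_of_cutting_pmf pair_pmf_def map_bind_pmf spmf_of_pmf_bind
          bind_return_pmf del: map_spmf_of_pmf)
  qed
  then show ?thesis
    by (simp add: cutting_pmf_def[of A] spmf_of_pmf_bind[symmetric] map_the_spmf_of_pmf)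
qed

lemma hclustering_HNode:
  "hclustering B l \<Longrightarrow> hclustering C r \<Longrightarrow> B \<inter> C = {} \<Longrightarrow> hclustering (B \<union> C) (HNode l r)"
  by (simp add: hclustering_def)

lemma hclustering_cutting_pmf:
  assumes "finite A" "A \<noteq> {}" "T \<in> set_pmf (cutting_pmf A)"
  shows "hclustering A T"
  using assms
proof (induction A arbitrary: T rule: cluster_induct)
  case (singleton x)
  then show ?case by (simp add: cutting_pmf_singleton hclustering_def)
next
  case (cut A)
  from cut.prems obtain B l r where B: "B \<in> Pow A - {{}, A}" and T: "T = HNode l r"
    and lr: "l \<in> set_pmf (cutting_pmf B)" "r \<in> set_pmf (cutting_pmf (A - B))"
    unfolding cutting_pmf_rec[OF cut.hyps(2)] using nontrivial_subsets[OF cut.hyps(2)] by auto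
  have "hclustering (B \<union> (A - B)) T"
    unfolding T using cut.IH[OF B] lr by (intro hclustering_HNode) auto
  moreover have "B \<union> (A - B) = A" using B by auto
  ultimately show ?case by simp
qed

lemma finite_set_cutting_pmf:
  assumes "finite A" "A \<noteq> {}"
  shows "finite (set_pmf (cutting_pmf A))"
  using hclustering_cutting_pmf[OF assms] finite_hclusterings[OF assms(1)]
  by (metis finite_subset mem_Collect_eq subsetI)

section \<open>The expected size of the subtree at a lowest common ancestor\<close>

abbreviation lca_size :: "'a set \<Rightarrow> 'a hctree \<Rightarrow> real" where
  "lca_size e T \<equiv> real (length (leaves (lca_subtree T e)))"

lemma length_leaves: "hclustering A T \<Longrightarrow> length (leaves T) = card A"
  by (auto simp: hclustering_def distinct_card)

lemma lca_size_le: "lca_size e T \<le> length (leaves T)"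
  by (induction T) auto

lemma sum_Pow_insert:
  assumes "finite A" "x \<notin> A"
  shows "sum f (Pow (insert x A)) = (\<Sum>B\<in>Pow A. f B + f (insert x B))"
proof -
  have "inj_on (insert x) (Pow A)" using assms(2) by (auto simp: inj_on_def)
  moreover have "sum f (Pow A \<union> insert x ` Pow A) = sum f (Pow A) + sum f (insert x ` Pow A)"
    using assms by (intro sum.union_disjoint) auto
  ultimately show ?thesis
    by (simp add: Pow_insert sum.reindex sum.distrib)
qed

text \<open>The expected \<open>lca_size {i, j}\<close> after the cut \<open>(B, A - B)\<close>. The trivial cuts \<open>{}\<close> and \<open>A\<close>
  get the average value \<open>(2 n + 2) / 3\<close>, so removing them does not change the mean.\<close>

lemma sum_cut_values:
  fixes i j :: 'a
  assumes "finite A" "i \<in> A" "j \<in> A" "i \<noteq> j"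
  defines "h \<equiv> \<lambda>B. if i \<in> B \<and> j \<in> B then (2 * real (card B) + 2) / 3
    else if i \<notin> B \<and> j \<notin> B then (2 * real (card (A - B)) + 2) / 3 else real (card A)"
  shows "sum h (Pow A - {{}, A}) = real (card (Pow A - {{}, A})) * ((2 * real (card A) + 2) / 3)"
proof -
  define D where "D = A - {i, j}"
  have D: "finite D" "i \<notin> D" "j \<notin> D" and A: "A = insert i (insert j D)"
    using assms(1-3) by (auto simp: D_def)
  have n: "card A = card D + 2" using D A assms(4) by simp
  define m where "m = (2 * real (card A) + 2) / 3"
  have "sum h (Pow A) = (\<Sum>C\<in>Pow D. h C + h (insert i C) + (h (insert j C) + h (insert i (insert j C))))"
    unfolding A using D assms(4) by (simp add: sum_Pow_insert)
  also have "\<dots> = (\<Sum>C\<in>Pow D. 4 * m)"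
  proof (rule sum.cong[OF refl])
    fix C assume "C \<in> Pow D"
    then have C: "C \<subseteq> D" "finite C" "i \<notin> C" "j \<notin> C" using D by (auto intro: finite_subset)
    have "card (A - C) + card C = card A"
      using C A D(1) by (simp add: card_Diff_subset card_mono n subset_insertI2)
    then have "real (card (A - C)) = real (card A) - card C" by linarith
    \<comment> \<open>With \<open>c = card C\<close> and \<open>n = card A\<close> the terms are
      \<open>(2 * (n - c) + 2) / 3\<close>, \<open>n\<close>, \<open>n\<close> and
      \<open>(2 * (c + 2) + 2) / 3\<close>; \<open>c\<close> cancels and
      \<open>(8 * n + 8) / 3\<close> remains.\<close>
    then show "h C + h (insert i C) + (h (insert j C) + h (insert i (insert j C))) = 4 * m"
      using C assms(4) by (simp add: h_def m_def field_simps)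
  qed
  also have "\<dots> = card (Pow A) * m"
    using D(1) assms(1) by (simp add: card_Pow n power_add)
  finally have P: "sum h (Pow A) = card (Pow A) * m" .
  have split: "sum f (Pow A) = sum f (Pow A - {{}, A}) + (f {} + f A)" for f :: "'a set \<Rightarrow> real"
  proof -
    have "{} \<noteq> A" using assms(2) by blast
    then show ?thesis
      using sum.subset_diff[of "{{}, A}" "Pow A" f] assms(1) by simp
  qed
  have "h {} = m" "h A = m" using assms(2,3) by (simp_all add: h_def m_def)
  \<comment> \<open>The constant 1 turns \<open>split\<close> into a count: two subsets are removed,
    together with the value \<open>2 * m\<close>.\<close>
  with P split[of h] split[of "\<lambda>_. 1"]
  have "sum h (Pow A - {{}, A}) = card (Pow A - {{}, A}) * m"
    by (simp add: algebra_simps)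
  then show ?thesis by (simp add: m_def)
qed

text \<open>Condition on the first cut. If it separates \<open>i\<close> and \<open>j\<close>, their
  lowest common ancestor is the root; otherwise it lies in the part containing both, where the
  induction hypothesis applies. \<open>sum_cut_values\<close> averages the results.\<close>

lemma expectation_lca_size:
  assumes "finite A" "A \<noteq> {}" "i \<in> A" "j \<in> A" "i \<noteq> j"
  shows "measure_pmf.expectation (cutting_pmf A) (lca_size {i, j}) = (2 * real (card A) + 2) / 3"
  using assms
proof (induction A rule: cluster_induct)
  case (singleton x)
  then show ?case by simp
next
  case (cut A)
  define S where "S = Pow A - {{}, A}"
  have S: "finite S" "S \<noteq> {}" using nontrivial_subsets[OF cut.hyps(2)] by (simp_all add: S_def)
  define N where "N B = map_pmf (\<lambda>(l, r). HNode l r)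
    (pair_pmf (cutting_pmf B) (cutting_pmf (A - B)))" for B
  define h where "h B = (if i \<in> B \<and> j \<in> B then (2 * real (card B) + 2) / 3
    else if i \<notin> B \<and> j \<notin> B then (2 * real (card (A - B)) + 2) / 3 else real (card A))" for B
  have B: "finite B" "B \<noteq> {}" "finite (A - B)" "A - B \<noteq> {}" "B \<subseteq> A" if "B \<in> S" for B
    using that cut.hyps by (auto simp: S_def intro: finite_subset)
  have N: "measure_pmf.expectation (N B) (lca_size {i, j}) = h B" if "B \<in> S" for B
  proof -
    note B = B[OF that]
    have IH: "measure_pmf.expectation (cutting_pmf C) (lca_size {i, j}) = (2 * real (card C) + 2) / 3"
      if "i \<in> C" "j \<in> C" "C = B \<or> C = A - B" for C
      using cut.IH[of B] \<open>B \<in> S\<close> that cut.prems by (auto simp: S_def)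
    \<comment> \<open>The integrand matters only on the support, where \<open>l\<close> and
      \<open>r\<close> are clusterings of \<open>B\<close> and \<open>A - B\<close>. Choosing
      \<open>f\<close> to ignore one component reduces to a marginal.\<close>
    have ex: "measure_pmf.expectation (N B) (lca_size {i, j})
        = measure_pmf.expectation (pair_pmf (cutting_pmf B) (cutting_pmf (A - B))) f"
      if "\<And>l r. hclustering B l \<Longrightarrow> hclustering (A - B) r \<Longrightarrow> lca_size {i, j} (HNode l r) = f (l, r)" for f
      unfolding N_def integral_map_pmf
      using that hclustering_cutting_pmf[OF B(1,2)] hclustering_cutting_pmf[OF B(3,4)]
      by (intro integral_cong_AE) (auto simp: AE_measure_pmf_iff)
    consider "i \<in> B" "j \<in> B" | "i \<notin> B" "j \<notin> B" | "i \<in> B \<longleftrightarrow> j \<notin> B" by blast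
    then show ?thesis
    proof cases
      case 1
      have "measure_pmf.expectation (N B) (lca_size {i, j})
          = measure_pmf.expectation (map_pmf fst (pair_pmf (cutting_pmf B) (cutting_pmf (A - B)))) (lca_size {i, j})"
        unfolding integral_map_pmf using 1 by (intro ex) (auto simp: hclustering_def)
      then show ?thesis using 1 IH[of B] by (simp add: map_fst_pair_pmf h_def)
    next
      case 2
      have "measure_pmf.expectation (N B) (lca_size {i, j})
          = measure_pmf.expectation (map_pmf snd (pair_pmf (cutting_pmf B) (cutting_pmf (A - B)))) (lca_size {i, j})"
        unfolding integral_map_pmf using 2 cut.prems by (intro ex) (auto simp: hclustering_def)
      then show ?thesis using 2 IH[of "A - B"] cut.prems by (simp add: map_snd_pair_pmf h_def)
    next
      case 3
      have "card B + card (A - B) = card A"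
        using card_Un_disjoint[of B "A - B"] B by (simp add: Un_absorb1)
      then have "measure_pmf.expectation (N B) (lca_size {i, j})
          = measure_pmf.expectation (pair_pmf (cutting_pmf B) (cutting_pmf (A - B))) (\<lambda>_. real (card A))"
        using 3 by (intro ex) (auto simp: hclustering_def length_leaves distinct_card[symmetric])
      then show ?thesis using 3 by (auto simp: h_def)
    qed
  qed
  \<comment> \<open>Total expectation over the uniform first cut; the finite supports of the
    \<open>N B\<close> justify it.\<close>
  have "measure_pmf.expectation (cutting_pmf A) (lca_size {i, j})
      = (\<Sum>B\<in>S. measure_pmf.expectation (N B) (lca_size {i, j}) /\<^sub>R real (card S))"
    unfolding cutting_pmf_rec[OF cut.hyps(2)] S_def[symmetric] N_def[symmetric]
    using S B by (intro pmf_expectation_bind_pmf_of_set) (auto simp: N_def finite_set_cutting_pmf)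
  also have "\<dots> = sum h S / card S"
    using N by (simp add: divide_inverse_commute sum_distrib_left)
  also have "sum h S = card S * ((2 * real (card A) + 2) / 3)"
    unfolding S_def h_def using cut by (intro sum_cut_values) auto
  finally show ?case using S by simp
qed

section \<open>The approximation guarantee\<close>

theorem theorem3:
  fixes V :: "'a set" and E :: "'a set set" and w :: "'a set \<Rightarrow> real"
  assumes "finite V" and "V \<noteq> {}"
    and "\<And>e. e \<in> E \<Longrightarrow> e \<subseteq> V \<and> card e = 2"
    and "\<And>e. e \<in> E \<Longrightarrow> 0 \<le> w e"
  shows "lossless_spmf (recursive_random_cutting V)
    \<and> (\<forall>T \<in> set_spmf (recursive_random_cutting V). hclustering V T)
    \<and> (\<integral>T. dissim_obj E w T \<partial>measure_spmf (recursive_random_cutting V))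
        \<ge> 2/3 * Max (dissim_obj E w ` {T'. hclustering V T'})"
proof (intro conjI ballI)
  show "lossless_spmf (recursive_random_cutting V)"
    using assms(1,2) by (rule lossless_recursive_random_cutting)
  note cut = spmf_of_cutting_pmf[OF assms(1,2)]
  show "hclustering V T" if "T \<in> set_spmf (recursive_random_cutting V)" for T
    using that hclustering_cutting_pmf[OF assms(1,2)] by (simp add: cut)
  have "Max (dissim_obj E w ` {T'. hclustering V T'}) \<le> (\<Sum>e\<in>E. w e * card V)"
  proof (intro Max.boundedI)
    fix v assume "v \<in> dissim_obj E w ` {T'. hclustering V T'}"
    then obtain T where T: "hclustering V T" and v: "v = dissim_obj E w T" by auto
    show "v \<le> (\<Sum>e\<in>E. w e * card V)"
      unfolding v dissim_obj_def using assms(4) lca_size_le[of T] length_leaves[OF T]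
      by (intro sum_mono mult_left_mono) auto
  qed (use finite_hclusterings[OF assms(1)] ex_hclustering[OF assms(1,2)] in auto)
  then have "2/3 * Max (dissim_obj E w ` {T'. hclustering V T'}) \<le> 2/3 * (\<Sum>e\<in>E. w e * card V)"
    by simp
  also have "\<dots> = (\<Sum>e\<in>E. w e * (2 * real (card V) / 3))"
    unfolding sum_distrib_left by (intro sum.cong) auto
  \<comment> \<open>Each edge has slack 2/3, as its exact expectation is
    \<open>(2 * card V + 2) / 3\<close>.\<close>
  also have "\<dots> \<le> (\<Sum>e\<in>E. w e * measure_pmf.expectation (cutting_pmf V) (lca_size e))"
  proof (intro sum_mono mult_left_mono)
    fix e assume e: "e \<in> E"
    then obtain i j where "e = {i, j}" "i \<noteq> j" using assms(3) by (meson card_2_iff)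
    then show "2 * real (card V) / 3 \<le> measure_pmf.expectation (cutting_pmf V) (lca_size e)"
      using expectation_lca_size[OF assms(1,2), of i j] assms(3)[OF e] by simp
  qed (use assms(4) in auto)
  also have "\<dots> = (\<integral>T. dissim_obj E w T \<partial>measure_spmf (recursive_random_cutting V))"
    \<comment> \<open>Linearity of expectation; finite support gives integrability.\<close>
    unfolding cut measure_spmf_spmf_of_pmf dissim_obj_def
    by (simp add: integrable_measure_pmf_finite finite_set_cutting_pmf assms(1,2))
  finally show "(\<integral>T. dissim_obj E w T \<partial>measure_spmf (recursive_random_cutting V))
    \<ge> 2/3 * Max (dissim_obj E w ` {T'. hclustering V T'})" .
qed

end
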